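(* Let $0<\beta<1$, let $h>0$ be a constant, let $p:\mathbb{R}\to\mathbb{R}$ be càdlàg, let $q:\mathbb{R}\to\mathbb{R}_+$, and for each $s\in\mathbb{R}$ let $v(\cdot,s):[s,\infty)\to\mathbb{R}_+$ be an absolutely continuous subsolution of $$y'(r,s)=-h\,y(r,s)^\beta+p(r),\quad r\ge s,\qquad y(s,s)=q(s).$$ Assume that $p(s)=o(|s|^{\frac{\beta}{1-\beta}})$ and $q(s)=o(|s|^{\frac1{1-\beta}})$ for $s\to-\infty$, i.e. for each $\varepsilon>0$ there are $s_p(\varepsilon),s_q(\varepsilon)$ such that $|p(s)|\le\varepsilon|s|^{\frac{\beta}{1-\beta}}$ for all $s\le s_p(\varepsilon)$ and $q(s)\le\varepsilon|s|^{\frac1{1-\beta}}$ for all $s\le s_q(\varepsilon)$. Then for each $t\in\mathbb{R}$ there are $s_0=s_0(t,s_q,h)\in\mathbb{R}$, $s_0\le t$, and $R=R(t,p,s_p,h)>0$ (depending only on the indicated quantities) such that $$v(t,s)\le R(t,p,s_p,h)\quad\text{for all }s\le s_0,$$ and $R(t,p,s_p,h)=o(|t|^{\frac1{1-\beta}})$ for $t\to-\infty$.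
   Context: $\mathbb{R}_+=[0,\infty)$. Subsolution means: $v(\cdot,s)$ is absolutely continuous on compact subintervals of $[s,\infty)$, its derivative in the first variable satisfies $v'(r,s)\le-h\,v(r,s)^\beta+p(r)$ for almost every $r\ge s$, and $v(s,s)\le q(s)$. Here $s_p,s_q$ denote the functions $\varepsilon\mapsto s_p(\varepsilon)$, $\varepsilon\mapsto s_q(\varepsilon)$; the dependence of $s_0,R$ on the fixed exponent $\beta$ is suppressed. *)

theory Defs
  imports "HOL-Analysis.Analysis" "HOL-Library.Landau_Symbols"
begin

definition cadlag :: "(real \<Rightarrow> real) \<Rightarrow> bool" where
  "cadlag f \<longleftrightarrow> (\<forall>x. (f \<longlongrightarrow> f x) (at_right x) \<and> (\<exists>l. (f \<longlongrightarrow> l) (at_left x)))"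

text \<open>
  Absolute continuity of a function (the library's \<^const>\<open>absolutely_continuous\<close> is about
  measures). The finitely many pairwise non-overlapping intervals are indexed by \<open>i < n\<close>;
  they may be degenerate, which adds nothing to either sum.
\<close>

definition absolutely_continuous_fun_on :: "real set \<Rightarrow> (real \<Rightarrow> real) \<Rightarrow> bool" where
  "absolutely_continuous_fun_on S f \<longleftrightarrow>
    (\<forall>\<epsilon>>0. \<exists>\<delta>>0. \<forall>(n::nat) a b.
      (\<forall>i<n. a i \<le> b i \<and> {a i..b i} \<subseteq> S) \<longrightarrow>
      disjoint_family_on (\<lambda>i. {a i<..<b i}) {..<n} \<longrightarrow>
      (\<Sum>i<n. b i - a i) < \<delta> \<longrightarrow>
      (\<Sum>i<n. \<bar>f (b i) - f (a i)\<bar>) < \<epsilon>)"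

text \<open>
  Absolutely continuous subsolution \<open>y : [s, \<infinity>) \<rightarrow> \<real>\<close> of
  \<open>y' = - h y\<^sup>\<beta> + p\<close>, \<open>y(s) = y0\<close>. Only values of \<open>y\<close> on \<open>{s..}\<close> matter, hence the
  derivative within \<open>{s..}\<close>. For nonnegative \<open>y\<close> and \<open>\<beta> > 0\<close>, \<open>y r powr \<beta>\<close> is the usual
  power, with value \<open>0\<close> at \<open>y r = 0\<close>.
\<close>

definition subsolution ::
    "real \<Rightarrow> real \<Rightarrow> (real \<Rightarrow> real) \<Rightarrow> real \<Rightarrow> real \<Rightarrow> (real \<Rightarrow> real) \<Rightarrow> bool" where
  "subsolution \<beta> h p s y0 y \<longleftrightarrow>
    (\<forall>a b. s \<le> a \<longrightarrow> a \<le> b \<longrightarrow> absolutely_continuous_fun_on {a..b} y) \<and>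
    (AE r in lborel. s \<le> r \<longrightarrow>
      (\<exists>D. (y has_real_derivative D) (at r within {s..}) \<and> D \<le> - h * y r powr \<beta> + p r)) \<and>
    y s \<le> y0"

end

theory Submission
  imports Defs "HOL-Real_Asymp.Real_Asymp"
begin

text \<open>
  The equation has the natural scale \<open>\<bar>r\<bar> powr (1 / (1 - \<beta>))\<close>: for \<open>r < 0\<close> and a small
  coefficient \<open>a > 0\<close>, the function \<open>z r = a * \<bar>r\<bar> powr (1 / (1 - \<beta>))\<close> is a supersolution as
  long as \<open>\<bar>p r\<bar> \<le> a * \<bar>r\<bar> powr (\<beta> / (1 - \<beta>))\<close>. Indeed the derivative of \<open>z\<close>, the
  damping and the bound on \<open>p\<close> are all multiples of \<open>\<bar>r\<bar> powr (\<beta> / (1 - \<beta>))\<close>, with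
  coefficients \<open>- a / (1 - \<beta>)\<close>, \<open>- h * a powr \<beta>\<close> and \<open>a\<close>, and \<open>a powr \<beta>\<close>
  dominates \<open>a\<close> for small \<open>a\<close>. A subsolution that starts below this barrier stays below it
  (\<open>subsolution_le_power_barrier\<close>), at least up to the time \<open>sp a\<close>.

  The choice of \<open>s0\<close> needs care: it may depend on \<open>sq\<close>, but not on \<open>sp\<close>, while how fast
  the coefficient \<open>a\<close> can be lowered as \<open>t \<rightarrow> -\<infinity>\<close> depends on \<open>sp\<close>. This is resolved
  by lowering the initial coefficient at a fixed rate: for \<open>s \<le> s0 t\<close> the initial value is below
  the barrier whose coefficient is the minimum of \<open>1 / (1 + \<bar>t\<bar>)\<close> and a constant. It is then
  also below every barrier with a larger coefficient \<open>a\<close>, and \<open>sp\<close> only determines which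
  \<open>a\<close> can be used at time \<open>t\<close>. As every \<open>a > 0\<close> can be used for all sufficiently negative
  \<open>t\<close>, the supremum \<open>R\<close> of the values at time \<open>t\<close> of all these subsolutions is
  \<open>o(\<bar>t\<bar> powr (1 / (1 - \<beta>)))\<close> (\<open>uniform_bound_smallo\<close>). It is finite for every \<open>t\<close>
  because \<open>p\<close> is bounded on the compact interval that is left after the barrier has been used as
  far as it holds (\<open>bdd_above_subsolution_values\<close>).

  Comparison with a barrier (\<open>subsolution_le_barrier\<close>) rests on the fact that an absolutely
  continuous function whose derivative is nonpositive almost everywhere is nonincreasing
  (\<open>absolutely_continuous_fun_on_AE_derivative_nonpos\<close>).
\<close>

section \<open>Absolutely continuous functions\<close>

text \<open>
  The pieces of a tagged division form a finite set without a natural enumeration; absolute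
  continuity is therefore needed for families over an arbitrary finite index set.
\<close>

lemma absolutely_continuous_fun_on_finite_family:
  fixes f :: "real \<Rightarrow> real"
  assumes "absolutely_continuous_fun_on S f" and "0 < \<epsilon>"
  shows "\<exists>\<delta>>0. \<forall>(I :: 'i set) a b. finite I \<longrightarrow>
      (\<forall>i\<in>I. a i \<le> b i \<and> {a i..b i} \<subseteq> S) \<longrightarrow>
      disjoint_family_on (\<lambda>i. {a i<..<b i}) I \<longrightarrow>
      (\<Sum>i\<in>I. b i - a i) < \<delta> \<longrightarrow> (\<Sum>i\<in>I. \<bar>f (b i) - f (a i)\<bar>) < \<epsilon>"
proof -
  from assms obtain \<delta> where "0 < \<delta>"
    and \<delta>: "\<And>(n::nat) a b. (\<forall>i<n. a i \<le> b i \<and> {a i..b i} \<subseteq> S) \<Longrightarrow>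
      disjoint_family_on (\<lambda>i. {a i<..<b i}) {..<n} \<Longrightarrow> (\<Sum>i<n. b i - a i) < \<delta> \<Longrightarrow>
      (\<Sum>i<n. \<bar>f (b i) - f (a i)\<bar>) < \<epsilon>"
    unfolding absolutely_continuous_fun_on_def by meson
  show ?thesis
  proof (intro exI[of _ \<delta>] conjI allI impI)
    show "0 < \<delta>" by fact
  next
    fix I :: "'i set" and a b :: "'i \<Rightarrow> real"
    assume I: "finite I" "\<forall>i\<in>I. a i \<le> b i \<and> {a i..b i} \<subseteq> S"
      and disj: "disjoint_family_on (\<lambda>i. {a i<..<b i}) I"
      and len: "(\<Sum>i\<in>I. b i - a i) < \<delta>"
    obtain g where g: "bij_betw g {..<card I} I"
      using ex_bij_betw_nat_finite[OF \<open>finite I\<close>] by (auto simp: atLeast0LessThan)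
    have reindex: "(\<Sum>j<card I. F (g j)) = (\<Sum>i\<in>I. F i)" for F :: "'i \<Rightarrow> real"
      using sum.reindex_bij_betw[OF g] by simp
    have "\<forall>j<card I. a (g j) \<le> b (g j) \<and> {a (g j)..b (g j)} \<subseteq> S"
      using I(2) bij_betwE[OF g] by blast
    moreover have "disjoint_family_on (\<lambda>j. {a (g j)<..<b (g j)}) {..<card I}"
      using disj bij_betwE[OF g] bij_betw_imp_inj_on[OF g]
      unfolding disjoint_family_on_def by (metis inj_onD)
    moreover have "(\<Sum>j<card I. b (g j) - a (g j)) < \<delta>"
      using len reindex[of "\<lambda>i. b i - a i"] by simp
    ultimately have "(\<Sum>j<card I. \<bar>f (b (g j)) - f (a (g j))\<bar>) < \<epsilon>"
      by (rule \<delta>)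
    then show "(\<Sum>i\<in>I. \<bar>f (b i) - f (a i)\<bar>) < \<epsilon>"
      using reindex[of "\<lambda>i. \<bar>f (b i) - f (a i)\<bar>"] by simp
  qed
qed

lemma absolutely_continuous_fun_on_diff:
  assumes "absolutely_continuous_fun_on S f" and "absolutely_continuous_fun_on S g"
  shows "absolutely_continuous_fun_on S (\<lambda>x. f x - g x)"
  unfolding absolutely_continuous_fun_on_def
proof (intro allI impI)
  fix \<epsilon> :: real assume "0 < \<epsilon>"
  then have "0 < \<epsilon> / 2" by simp
  from assms(1) this obtain \<delta>1 where "0 < \<delta>1"
    and \<delta>1: "\<And>(n::nat) a b. (\<forall>i<n. a i \<le> b i \<and> {a i..b i} \<subseteq> S) \<Longrightarrow>
      disjoint_family_on (\<lambda>i. {a i<..<b i}) {..<n} \<Longrightarrow> (\<Sum>i<n. b i - a i) < \<delta>1 \<Longrightarrow>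
      (\<Sum>i<n. \<bar>f (b i) - f (a i)\<bar>) < \<epsilon> / 2"
    unfolding absolutely_continuous_fun_on_def by meson
  from assms(2) \<open>0 < \<epsilon> / 2\<close> obtain \<delta>2 where "0 < \<delta>2"
    and \<delta>2: "\<And>(n::nat) a b. (\<forall>i<n. a i \<le> b i \<and> {a i..b i} \<subseteq> S) \<Longrightarrow>
      disjoint_family_on (\<lambda>i. {a i<..<b i}) {..<n} \<Longrightarrow> (\<Sum>i<n. b i - a i) < \<delta>2 \<Longrightarrow>
      (\<Sum>i<n. \<bar>g (b i) - g (a i)\<bar>) < \<epsilon> / 2"
    unfolding absolutely_continuous_fun_on_def by meson
  show "\<exists>\<delta>>0. \<forall>(n::nat) a b.
      (\<forall>i<n. a i \<le> b i \<and> {a i..b i} \<subseteq> S) \<longrightarrow>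
      disjoint_family_on (\<lambda>i. {a i<..<b i}) {..<n} \<longrightarrow>
      (\<Sum>i<n. b i - a i) < \<delta> \<longrightarrow>
      (\<Sum>i<n. \<bar>(f (b i) - g (b i)) - (f (a i) - g (a i))\<bar>) < \<epsilon>"
  proof (intro exI[of _ "min \<delta>1 \<delta>2"] conjI allI impI)
    show "0 < min \<delta>1 \<delta>2" using \<open>0 < \<delta>1\<close> \<open>0 < \<delta>2\<close> by simp
  next
    fix n :: nat and a b :: "nat \<Rightarrow> real"
    assume *: "\<forall>i<n. a i \<le> b i \<and> {a i..b i} \<subseteq> S" "disjoint_family_on (\<lambda>i. {a i<..<b i}) {..<n}"
      and "(\<Sum>i<n. b i - a i) < min \<delta>1 \<delta>2"
    then have "(\<Sum>i<n. b i - a i) < \<delta>1" "(\<Sum>i<n. b i - a i) < \<delta>2" by simp_all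
    with \<delta>1[OF *] \<delta>2[OF *]
    have "(\<Sum>i<n. \<bar>f (b i) - f (a i)\<bar>) + (\<Sum>i<n. \<bar>g (b i) - g (a i)\<bar>) < \<epsilon>" by linarith
    moreover have "(\<Sum>i<n. \<bar>(f (b i) - g (b i)) - (f (a i) - g (a i))\<bar>)
        \<le> (\<Sum>i<n. \<bar>f (b i) - f (a i)\<bar> + \<bar>g (b i) - g (a i)\<bar>)"
      by (intro sum_mono) linarith
    ultimately show "(\<Sum>i<n. \<bar>(f (b i) - g (b i)) - (f (a i) - g (a i))\<bar>) < \<epsilon>"
      by (simp add: sum.distrib)
  qed
qed

lemma lipschitz_imp_absolutely_continuous_fun_on:
  fixes f :: "real \<Rightarrow> real"
  assumes lip: "\<And>x y. x \<in> S \<Longrightarrow> y \<in> S \<Longrightarrow> \<bar>f y - f x\<bar> \<le> L * \<bar>y - x\<bar>"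
  shows "absolutely_continuous_fun_on S f"
  unfolding absolutely_continuous_fun_on_def
proof (intro allI impI)
  fix \<epsilon> :: real assume "0 < \<epsilon>"
  define M where "M = \<bar>L\<bar> + 1"
  have "0 < M" by (simp add: M_def)
  show "\<exists>\<delta>>0. \<forall>(n::nat) a b.
      (\<forall>i<n. a i \<le> b i \<and> {a i..b i} \<subseteq> S) \<longrightarrow>
      disjoint_family_on (\<lambda>i. {a i<..<b i}) {..<n} \<longrightarrow>
      (\<Sum>i<n. b i - a i) < \<delta> \<longrightarrow>
      (\<Sum>i<n. \<bar>f (b i) - f (a i)\<bar>) < \<epsilon>"
  proof (intro exI[of _ "\<epsilon> / M"] conjI allI impI)
    show "0 < \<epsilon> / M" using \<open>0 < \<epsilon>\<close> \<open>0 < M\<close> by simp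
  next
    fix n :: nat and a b :: "nat \<Rightarrow> real"
    assume *: "\<forall>i<n. a i \<le> b i \<and> {a i..b i} \<subseteq> S" and len: "(\<Sum>i<n. b i - a i) < \<epsilon> / M"
    have "(\<Sum>i<n. \<bar>f (b i) - f (a i)\<bar>) \<le> (\<Sum>i<n. M * (b i - a i))"
    proof (rule sum_mono)
      fix i assume "i \<in> {..<n}"
      with * have "a i \<le> b i" "{a i..b i} \<subseteq> S" by auto
      then have i: "a i \<le> b i" "a i \<in> S" "b i \<in> S" by auto
      have "\<bar>f (b i) - f (a i)\<bar> \<le> L * \<bar>b i - a i\<bar>" by (rule lip[OF i(2,3)])
      also have "\<dots> \<le> M * \<bar>b i - a i\<bar>" unfolding M_def by (intro mult_right_mono) auto
      finally show "\<bar>f (b i) - f (a i)\<bar> \<le> M * (b i - a i)" using i(1) by simp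
    qed
    also have "\<dots> < \<epsilon>"
      using len \<open>0 < M\<close> by (simp add: sum_distrib_left[symmetric] pos_less_divide_eq mult.commute)
    finally show "(\<Sum>i<n. \<bar>f (b i) - f (a i)\<bar>) < \<epsilon>" .
  qed
qed

lemma absolutely_continuous_fun_on_imp_continuous_on:
  assumes "absolutely_continuous_fun_on {a..b} f"
  shows "continuous_on {a..b} f"
  unfolding continuous_on_iff
proof (intro ballI allI impI)
  fix x \<epsilon> :: real assume x: "x \<in> {a..b}" and "0 < \<epsilon>"
  obtain \<delta> where "0 < \<delta>"
    and \<delta>: "\<And>(I :: unit set) a' b'. finite I \<Longrightarrow> \<forall>i\<in>I. a' i \<le> b' i \<and> {a' i..b' i} \<subseteq> {a..b} \<Longrightarrow>
      disjoint_family_on (\<lambda>i. {a' i<..<b' i}) I \<Longrightarrow> (\<Sum>i\<in>I. b' i - a' i) < \<delta> \<Longrightarrow>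
      (\<Sum>i\<in>I. \<bar>f (b' i) - f (a' i)\<bar>) < \<epsilon>"
    using absolutely_continuous_fun_on_finite_family[OF assms \<open>0 < \<epsilon>\<close>] by blast
  have "dist (f y) (f x) < \<epsilon>" if "y \<in> {a..b}" "dist y x < \<delta>" for y
  proof -
    have "\<bar>f (max x y) - f (min x y)\<bar> < \<epsilon>"
      using \<delta>[of "{()}" "\<lambda>_. min x y" "\<lambda>_. max x y"] x that
      by (cases "x \<le> y") (simp_all add: disjoint_family_on_def dist_real_def)
    then show ?thesis
      by (cases "x \<le> y") (auto simp: dist_real_def abs_minus_commute)
  qed
  with \<open>0 < \<delta>\<close> show "\<exists>d>0. \<forall>x'\<in>{a..b}. dist x' x < d \<longrightarrow> dist (f x') (f x) < \<epsilon>" by blast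
qed

text \<open>
  In the monotonicity proof below this is how an open cover of small measure of a null set
  limits the total length of the intervals to which absolute continuity is applied.
\<close>

lemma sum_lengths_of_disjoint_subintervals:
  fixes a b :: "'i \<Rightarrow> real"
  assumes "finite I" and le: "\<And>i. i \<in> I \<Longrightarrow> a i \<le> b i \<and> {a i<..<b i} \<subseteq> U"
    and disj: "disjoint_family_on (\<lambda>i. {a i<..<b i}) I"
    and "U \<in> sets lborel" "emeasure lborel U < ennreal d" 
  shows "(\<Sum>i\<in>I. b i - a i) < d"
proof -
  have "ennreal (\<Sum>i\<in>I. b i - a i) = (\<Sum>i\<in>I. ennreal (b i - a i))"
    using le by (intro sum_ennreal[symmetric]) auto
  also have "\<dots> = (\<Sum>i\<in>I. emeasure lborel {a i<..<b i})"
    using le by (intro sum.cong) auto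
  also have "\<dots> = emeasure lborel (\<Union>i\<in>I. {a i<..<b i})"
    using disj \<open>finite I\<close> by (intro sum_emeasure) auto
  also have "\<dots> \<le> emeasure lborel U"
    using le \<open>U \<in> sets lborel\<close> by (intro emeasure_mono) auto
  also have "\<dots> < ennreal d" by fact
  finally show ?thesis
    using le by (subst (asm) ennreal_less_iff) (auto intro!: sum_nonneg)
qed

text \<open>
  The straddle argument: the linear approximation at \<^term>\<open>x\<close> is compared at both ends of an
  interval around \<^term>\<open>x\<close>, and since the two errors are proportional to \<^term>\<open>x - c\<close> and
  \<^term>\<open>d - x\<close>, they add up to a multiple of the length \<^term>\<open>d - c\<close>.
\<close>

lemma derivative_nonpos_imp_local_increment_bound:
  fixes f :: "real \<Rightarrow> real"
  assumes "(f has_real_derivative D) (at x within S)" and "D \<le> 0" and "0 < \<epsilon>"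
  obtains r where "0 < r"
    and "\<And>c d. c \<in> S \<Longrightarrow> d \<in> S \<Longrightarrow> c \<le> x \<Longrightarrow> x \<le> d \<Longrightarrow> {c..d} \<subseteq> ball x r \<Longrightarrow>
      f d - f c \<le> \<epsilon> * (d - c)"
proof -
  have "(f has_derivative (\<lambda>h. D * h)) (at x within S)"
    using assms(1) by (simp add: has_field_derivative_def)
  then obtain r where "0 < r"
    and r: "\<And>y. y \<in> S \<Longrightarrow> norm (y - x) < r \<Longrightarrow>
      norm (f y - f x - D * (y - x)) \<le> \<epsilon> * norm (y - x)"
    using \<open>0 < \<epsilon>\<close> unfolding has_derivative_within_alt by blast
  show thesis
  proof (rule that[OF \<open>0 < r\<close>])
    fix c d assume *: "c \<in> S" "d \<in> S" "c \<le> x" "x \<le> d" "{c..d} \<subseteq> ball x r"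
    then have "c \<in> ball x r" "d \<in> ball x r" by (auto simp del: mem_ball)
    then have "norm (c - x) < r" "norm (d - x) < r" by (auto simp: dist_real_def)
    from r[OF \<open>c \<in> S\<close> this(1)] r[OF \<open>d \<in> S\<close> this(2)] *
    have "\<bar>f c - f x - D * (c - x)\<bar> \<le> \<epsilon> * (x - c)" "\<bar>f d - f x - D * (d - x)\<bar> \<le> \<epsilon> * (d - x)"
      by auto
    then have "f d - f c \<le> \<epsilon> * (d - x) + \<epsilon> * (x - c) + (D * (d - x) - D * (c - x))"
      by linarith
    also have "\<dots> = \<epsilon> * (d - c) + D * (d - c)" by (simp add: algebra_simps)
    also have "\<dots> \<le> \<epsilon> * (d - c)"
      using * \<open>D \<le> 0\<close> by (simp add: mult_nonpos_nonneg)
    finally show "f d - f c \<le> \<epsilon> * (d - c)" .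
  qed
qed

text \<open>
  The proof is by Cousin's lemma, that is, by the existence of fine tagged divisions. Cover the
  exceptional null set \<open>N\<close> by an open set \<open>U\<close> of measure less than the \<open>\<delta>\<close> that belongs
  to \<open>\<epsilon>\<close>. Take a tagged division so fine that an interval tagged in \<open>N\<close> lies in \<open>U\<close>,
  and the increment of \<^term>\<open>f\<close> over any other interval is at most \<open>\<epsilon>\<close> times its length.
  The former intervals contribute at most \<open>\<epsilon>\<close> in total by absolute continuity, the latter at
  most \<open>\<epsilon> * (b - a)\<close>.
\<close>

lemma absolutely_continuous_fun_on_AE_derivative_nonpos:
  fixes f :: "real \<Rightarrow> real"
  assumes "a \<le> b" and ac: "absolutely_continuous_fun_on {a..b} f"
    and ae: "AE x in lborel. x \<in> {a..b} \<longrightarrow>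
      (\<exists>D\<le>0. (f has_real_derivative D) (at x within {a..b}))"
  shows "f b \<le> f a"
proof (rule field_le_epsilon)
  fix e :: real assume "0 < e"
  \<comment> \<open>the two kinds of intervals cost \<open>\<epsilon> * (b - a)\<close> and \<open>\<epsilon>\<close>, together \<open>e\<close>\<close>
  define \<epsilon> where "\<epsilon> = e / (b - a + 1)"
  have "0 < \<epsilon>" using \<open>a \<le> b\<close> \<open>0 < e\<close> by (simp add: \<epsilon>_def)
  obtain \<delta> where "0 < \<delta>"
    and \<delta>: "\<And>(I :: (real \<times> real set) set) a' b'. finite I \<Longrightarrow>
      \<forall>i\<in>I. a' i \<le> b' i \<and> {a' i..b' i} \<subseteq> {a..b} \<Longrightarrow>
      disjoint_family_on (\<lambda>i. {a' i<..<b' i}) I \<Longrightarrow> (\<Sum>i\<in>I. b' i - a' i) < \<delta> \<Longrightarrow>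
      (\<Sum>i\<in>I. \<bar>f (b' i) - f (a' i)\<bar>) < \<epsilon>"
    using absolutely_continuous_fun_on_finite_family[OF ac \<open>0 < \<epsilon>\<close>] by blast
  obtain N where N: "N \<in> null_sets lborel"
    and der: "\<And>x. x \<in> {a..b} - N \<Longrightarrow> \<exists>D\<le>0. (f has_real_derivative D) (at x within {a..b})"
    using ae by (auto elim!: AE_E3)
  obtain U where "open U" "N \<subseteq> U" and "emeasure lborel (U - N) < ennreal \<delta>"
    using outer_regular_lborel[OF _ \<open>0 < \<delta>\<close>, of N] null_setsD2[OF N] unfolding sets_lborel by blast
  then have U: "emeasure lborel U < ennreal \<delta>"
    using emeasure_Diff_null_set[OF N, of U] by simp
  have "\<exists>r. 0 < r \<and> (x \<in> N \<longrightarrow> ball x r \<subseteq> U) \<and>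
      (x \<notin> N \<longrightarrow> (\<forall>c d. c \<in> {a..b} \<longrightarrow> d \<in> {a..b} \<longrightarrow> c \<le> x \<longrightarrow> x \<le> d \<longrightarrow> {c..d} \<subseteq> ball x r \<longrightarrow>
        f d - f c \<le> \<epsilon> * (d - c)))" for x
  proof (cases "x \<in> N")
    case True
    with \<open>open U\<close> \<open>N \<subseteq> U\<close> show ?thesis by (auto simp: open_contains_ball)
  next
    case False
    show ?thesis
    proof (cases "x \<in> {a..b}")
      case True
      with False der obtain D where "D \<le> 0" "(f has_real_derivative D) (at x within {a..b})"
        by blast
      from derivative_nonpos_imp_local_increment_bound[OF this(2,1) \<open>0 < \<epsilon>\<close>]
      obtain r where "0 < r"
        "\<And>c d. c \<in> {a..b} \<Longrightarrow> d \<in> {a..b} \<Longrightarrow> c \<le> x \<Longrightarrow> x \<le> d \<Longrightarrow> {c..d} \<subseteq> ball x r \<Longrightarrow>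
          f d - f c \<le> \<epsilon> * (d - c)"
        by blast
      with False show ?thesis by blast
    next
      case out: False
      show ?thesis
        by (rule exI[of _ 1]) (use False out in auto)
    qed
  qed
  then obtain r where r_all: "\<forall>x. 0 < r x \<and> (x \<in> N \<longrightarrow> ball x (r x) \<subseteq> U) \<and>
      (x \<notin> N \<longrightarrow> (\<forall>c d. c \<in> {a..b} \<longrightarrow> d \<in> {a..b} \<longrightarrow> c \<le> x \<longrightarrow> x \<le> d \<longrightarrow> {c..d} \<subseteq> ball x (r x) \<longrightarrow>
        f d - f c \<le> \<epsilon> * (d - c)))"
    by (rule choice[OF allI, THEN exE])
  have r: "\<And>x. 0 < r x" "\<And>x. x \<in> N \<Longrightarrow> ball x (r x) \<subseteq> U"
    "\<And>x c d. x \<notin> N \<Longrightarrow> c \<in> {a..b} \<Longrightarrow> d \<in> {a..b} \<Longrightarrow> c \<le> x \<Longrightarrow> x \<le> d \<Longrightarrow>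
      {c..d} \<subseteq> ball x (r x) \<Longrightarrow> f d - f c \<le> \<epsilon> * (d - c)"
    using r_all by blast+
  have "gauge (\<lambda>x. ball x (r x))" using r(1) by (intro gaugeI) auto
  then obtain P where P: "P tagged_division_of {a..b}" and fine: "(\<lambda>x. ball x (r x)) fine P"
    using fine_division_exists_real by blast
  have "finite P" using P by auto
  have ivl: "{Inf K..Sup K} = K \<and> Inf K \<le> x \<and> x \<le> Sup K \<and> Inf K \<in> {a..b} \<and> Sup K \<in> {a..b}
      \<and> K \<subseteq> ball x (r x)"
    if xK: "(x, K) \<in> P" for x K
  proof -
    obtain c d where "K = {c..d}" using tagged_division_ofD(4)[OF P xK] by auto
    moreover have "x \<in> K" "K \<subseteq> {a..b}" using tagged_division_ofD(2,3)[OF P xK] by auto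
    moreover have "K \<subseteq> ball x (r x)" using fine xK by (auto simp: fine_def)
    ultimately show ?thesis by auto
  qed
  \<comment> \<open>the pieces of the division whose tag is exceptional\<close>
  define Q where "Q = {xK \<in> P. fst xK \<in> N}"
  have "finite Q" "Q \<subseteq> P" using \<open>finite P\<close> by (auto simp: Q_def)
  define lo hi where "lo = (\<lambda>xK :: real \<times> real set. Inf (snd xK))"
    and "hi = (\<lambda>xK :: real \<times> real set. Sup (snd xK))"
  have Q_sub: "lo i \<le> hi i \<and> {lo i..hi i} \<subseteq> {a..b} \<and> {lo i..hi i} \<subseteq> U" if "i \<in> Q" for i
  proof -
    obtain x K where i: "i = (x, K)" by (cases i)
    with that have "(x, K) \<in> P" "x \<in> N" by (auto simp: Q_def)
    from ivl[OF this(1)] r(2)[OF this(2)] tagged_division_ofD(3)[OF P this(1)]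
    have "lo i \<le> hi i" "{lo i..hi i} = K" "K \<subseteq> U" "K \<subseteq> {a..b}" unfolding i lo_def hi_def by auto
    then show ?thesis by simp
  qed
  have Q_disj: "disjoint_family_on (\<lambda>i. {lo i<..<hi i}) Q"
    unfolding disjoint_family_on_def
  proof (intro ballI impI)
    fix i j assume "i \<in> Q" "j \<in> Q" "i \<noteq> j"
    obtain x K y L where ij: "i = (x, K)" "j = (y, L)" by (metis surj_pair)
    with \<open>i \<in> Q\<close> \<open>j \<in> Q\<close> \<open>Q \<subseteq> P\<close> have *: "(x, K) \<in> P" "(y, L) \<in> P" by auto
    have "interior K \<inter> interior L = {}"
      using tagged_division_ofD(5)[OF P *] ij \<open>i \<noteq> j\<close> by auto
    moreover have "interior K = {lo i<..<hi i}" "interior L = {lo j<..<hi j}"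
      using ivl[OF *(1)] ivl[OF *(2)] interior_atLeastAtMost_real[of "Inf K" "Sup K"]
        interior_atLeastAtMost_real[of "Inf L" "Sup L"] by (simp_all add: ij lo_def hi_def)
    ultimately show "{lo i<..<hi i} \<inter> {lo j<..<hi j} = {}" by simp
  qed
  have "(\<Sum>i\<in>Q. hi i - lo i) < \<delta>"
  proof (rule sum_lengths_of_disjoint_subintervals[OF \<open>finite Q\<close> _ Q_disj _ U])
    show "lo i \<le> hi i \<and> {lo i<..<hi i} \<subseteq> U" if "i \<in> Q" for i
      using Q_sub[OF that] greaterThanLessThan_subseteq_atLeastAtMost_iff[of "lo i" "hi i" "lo i" "hi i"]
      by (blast intro: order_trans[of _ "{lo i..hi i}"])
  qed (use \<open>open U\<close> in auto)
  then have "(\<Sum>i\<in>Q. \<bar>f (hi i) - f (lo i)\<bar>) < \<epsilon>"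
    using Q_sub by (intro \<delta>[OF \<open>finite Q\<close> _ Q_disj]) auto
  moreover have "(\<Sum>i\<in>Q. f (hi i) - f (lo i)) \<le> (\<Sum>i\<in>Q. \<bar>f (hi i) - f (lo i)\<bar>)"
    by (intro sum_mono) auto
  ultimately have bad: "(\<Sum>i\<in>Q. f (hi i) - f (lo i)) \<le> \<epsilon>" by linarith
  have "(\<Sum>i\<in>P - Q. f (hi i) - f (lo i)) \<le> (\<Sum>i\<in>P - Q. \<epsilon> * (hi i - lo i))"
  proof (rule sum_mono)
    fix i assume "i \<in> P - Q"
    moreover obtain x K where i: "i = (x, K)" by (cases i)
    ultimately have "(x, K) \<in> P" "x \<notin> N" by (auto simp: Q_def)
    from ivl[OF this(1)] r(3)[OF this(2), of "Inf K" "Sup K"]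
    show "f (hi i) - f (lo i) \<le> \<epsilon> * (hi i - lo i)" by (simp add: i lo_def hi_def)
  qed
  also have "\<dots> \<le> (\<Sum>i\<in>P. \<epsilon> * (hi i - lo i))"
  proof (rule sum_mono2[OF \<open>finite P\<close>])
    fix i assume "i \<in> P - (P - Q)"
    then have "i \<in> Q" by auto
    with Q_sub[OF this] \<open>0 < \<epsilon>\<close> show "0 \<le> \<epsilon> * (hi i - lo i)" by simp
  qed auto
  also have "\<dots> = \<epsilon> * (b - a)"
    using additive_tagged_division_1[OF \<open>a \<le> b\<close> P, of "\<lambda>x. x"]
    by (simp add: lo_def hi_def sum_distrib_left[symmetric] split_beta)
  finally have good: "(\<Sum>i\<in>P - Q. f (hi i) - f (lo i)) \<le> \<epsilon> * (b - a)" .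
  have "f b - f a = (\<Sum>i\<in>P. f (hi i) - f (lo i))"
    using additive_tagged_division_1[OF \<open>a \<le> b\<close> P, of f] by (simp add: lo_def hi_def split_beta)
  also have "\<dots> = (\<Sum>i\<in>P - Q. f (hi i) - f (lo i)) + (\<Sum>i\<in>Q. f (hi i) - f (lo i))"
    by (rule sum.subset_diff[OF \<open>Q \<subseteq> P\<close> \<open>finite P\<close>])
  also have "\<dots> \<le> \<epsilon> * (b - a + 1)" using good bad by (simp add: algebra_simps)
  also have "\<dots> = e" using \<open>a \<le> b\<close> by (simp add: \<epsilon>_def)
  finally show "f b \<le> f a + e" by simp
qed

section \<open>Subsolutions and barriers\<close>

text \<open>
  The right-hand side decreases in the unknown. Hence, as long as \<^term>\<open>y\<close> lies above a
  supersolution \<^term>\<open>z\<close>, the difference \<^term>\<open>\<lambda>r. y r - z r\<close> has nonpositive derivative almost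
  everywhere and cannot grow: after the last time \<open>c\<close> with \<open>y c \<le> z c\<close> the graph of
  \<^term>\<open>y\<close> could never have come to lie above that of \<^term>\<open>z\<close>. The argument works
  through the monotonicity of the power, hence also at 0, where the power is not Lipschitz. The start \<^term>\<open>a\<close>
  of the comparison may be later than \<^term>\<open>s\<close>, so that barriers can be used one after the other.
\<close>

lemma subsolution_le_barrier:
  assumes sub: "subsolution \<beta> h p s y0 y" and "0 \<le> h" "0 \<le> \<beta>" and "s \<le> a" "a \<le> b"
    and z: "\<And>r. r \<in> {a..b} \<Longrightarrow> (z has_real_derivative z' r) (at r within {a..b})"
    and z'_cont: "continuous_on {a..b} z'"
    and super: "\<And>r. r \<in> {a..b} \<Longrightarrow> - h * z r powr \<beta> + p r \<le> z' r"
    and z_nonneg: "\<And>r. r \<in> {a..b} \<Longrightarrow> 0 \<le> z r"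
    and init: "y a \<le> z a"
  shows "y b \<le> z b"
proof (rule ccontr)
  assume "\<not> y b \<le> z b"
  define w where "w = (\<lambda>r. y r - z r)"
  have "absolutely_continuous_fun_on {a..b} y"
    using sub \<open>s \<le> a\<close> \<open>a \<le> b\<close> by (auto simp: subsolution_def)
  then have y_cont: "continuous_on {a..b} y"
    by (rule absolutely_continuous_fun_on_imp_continuous_on)
  have z_cont: "continuous_on {a..b} z"
    by (rule DERIV_continuous_on[OF z])
  have w_cont: "continuous_on {a..b} w"
    unfolding w_def by (intro continuous_intros y_cont z_cont)
  \<comment> \<open>the last time at which \<^term>\<open>y\<close> does not exceed the barrier\<close>
  define A where "A = {a..b} \<inter> w -` {..0}"
  have "closed A" unfolding A_def
    using w_cont by (intro continuous_closed_preimage) auto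
  moreover have "bounded A" by (rule bounded_subset[of "{a..b}"]) (auto simp: A_def)
  ultimately have "compact A" by (simp add: compact_eq_bounded_closed)
  moreover have "a \<in> A" using init \<open>a \<le> b\<close> by (auto simp: A_def w_def)
  ultimately obtain c where "c \<in> A" and c_max: "\<And>r. r \<in> A \<Longrightarrow> r \<le> c"
    using compact_attains_sup[of A] by auto
  have c: "a \<le> c" "c \<le> b" "w c \<le> 0" using \<open>c \<in> A\<close> by (auto simp: A_def)
  have above: "0 < w r" if "c < r" "r \<le> b" for r
    using c_max[of r] that c(1) by (fastforce simp: A_def)
  have "c < b" using \<open>\<not> y b \<le> z b\<close> c by (auto simp: w_def less_le)
  obtain L where L: "\<forall>r\<in>{a..b}. \<bar>z' r\<bar> \<le> L"
    using compact_imp_bounded[OF compact_continuous_image[OF z'_cont compact_Icc]]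
    by (auto simp: bounded_iff)
  have "absolutely_continuous_fun_on {c..b} z"
  proof (rule lipschitz_imp_absolutely_continuous_fun_on[where L = L])
    fix r r' assume "r \<in> {c..b}" "r' \<in> {c..b}"
    then show "\<bar>z r' - z r\<bar> \<le> L * \<bar>r' - r\<bar>"
      using field_differentiable_bound[of "{a..b}" z z' L r' r] z L c by (auto simp: convex_real_interval)
  qed
  moreover have "absolutely_continuous_fun_on {c..b} y"
    using sub \<open>s \<le> a\<close> c by (auto simp: subsolution_def)
  ultimately have w_ac: "absolutely_continuous_fun_on {c..b} w"
    unfolding w_def by (intro absolutely_continuous_fun_on_diff)
  have "AE r in lborel. s \<le> r \<longrightarrow>
      (\<exists>D. (y has_real_derivative D) (at r within {s..}) \<and> D \<le> - h * y r powr \<beta> + p r)"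
    using sub by (simp add: subsolution_def)
  moreover have "AE r in lborel. r \<noteq> c" by (rule AE_lborel_singleton)
  ultimately have "AE r in lborel. r \<in> {c..b} \<longrightarrow>
      (\<exists>D\<le>0. (w has_real_derivative D) (at r within {c..b}))"
  proof eventually_elim
    case (elim r)
    show ?case
    proof
      assume r: "r \<in> {c..b}"
      with elim c \<open>s \<le> a\<close> obtain D where D: "(y has_real_derivative D) (at r within {s..})"
        "D \<le> - h * y r powr \<beta> + p r" by auto
      have r': "r \<in> {a..b}" using r c by auto
      have "z r \<le> y r" using above[of r] elim(2) r by (auto simp: w_def)
      then have "h * z r powr \<beta> \<le> h * y r powr \<beta>"
        using z_nonneg[OF r'] \<open>0 \<le> h\<close> \<open>0 \<le> \<beta>\<close> by (intro mult_left_mono powr_mono2) auto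
      with D(2) super[OF r'] have "D - z' r \<le> 0" by linarith
      moreover have "(w has_real_derivative D - z' r) (at r within {c..b})"
        unfolding w_def using c \<open>s \<le> a\<close>
        by (intro DERIV_diff has_field_derivative_subset[OF D(1)]
            has_field_derivative_subset[OF z[OF r']]) auto
      ultimately show "\<exists>D\<le>0. (w has_real_derivative D) (at r within {c..b})" by blast
    qed
  qed
  then have "w b \<le> w c"
    using absolutely_continuous_fun_on_AE_derivative_nonpos[OF c(2) w_ac] by blast
  with \<open>c < b\<close> above[of b] c(3) show False by simp
qed

text \<open>
  The one-sided limits bound the function near each point; bisection makes this global.
\<close>

lemma cadlag_bounded_on_interval:
  assumes "cadlag f" and "a \<le> b"
  shows "\<exists>K. \<forall>x\<in>{a..b}. \<bar>f x\<bar> \<le> K"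
  using \<open>a \<le> b\<close>
proof (induction rule: Bolzano)
  case (trans a b c)
  then obtain K L where "\<forall>x\<in>{a..b}. \<bar>f x\<bar> \<le> K" "\<forall>x\<in>{b..c}. \<bar>f x\<bar> \<le> L" by blast
  then have "\<forall>x\<in>{a..c}. \<bar>f x\<bar> \<le> max K L" by (auto simp: le_max_iff_disj)
  then show ?case by blast
next
  case (local x)
  from \<open>cadlag f\<close> obtain l where "(f \<longlongrightarrow> f x) (at_right x)" "(f \<longlongrightarrow> l) (at_left x)"
    by (auto simp: cadlag_def)
  then have "\<forall>\<^sub>F y in at_right x. dist (f y) (f x) < 1" "\<forall>\<^sub>F y in at_left x. dist (f y) l < 1"
    by (auto intro: tendstoD)
  then obtain u v where u: "x < u" "\<And>y. x < y \<Longrightarrow> y < u \<Longrightarrow> \<bar>f y - f x\<bar> < 1"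
    and v: "v < x" "\<And>y. v < y \<Longrightarrow> y < x \<Longrightarrow> \<bar>f y - l\<bar> < 1"
    by (auto simp: eventually_at_right_field eventually_at_left_field dist_real_def)
  have bound: "\<bar>f y\<bar> \<le> \<bar>f x\<bar> + \<bar>l\<bar> + 1" if "v < y" "y < u" for y
    using u(2)[of y] v(2)[of y] that by (cases y x rule: linorder_cases) auto
  show ?case
  proof (rule exI[of _ "min (u - x) (x - v)"], intro conjI allI impI)
    show "0 < min (u - x) (x - v)" using u(1) v(1) by simp
  next
    fix a b assume "a \<le> x \<and> x \<le> b \<and> b - a < min (u - x) (x - v)"
    then show "\<exists>K. \<forall>y\<in>{a..b}. \<bar>f y\<bar> \<le> K"
      by (intro exI[of _ "\<bar>f x\<bar> + \<bar>l\<bar> + 1"] ballI bound) auto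
  qed
qed

text \<open>
  Up to this coefficient \<open>a\<close>, the damping \<open>h * a powr \<beta>\<close> is at least twice the speed
  \<open>a / (1 - \<beta>)\<close> with which the barrier \<open>a * \<bar>r\<bar> powr (1 / (1 - \<beta>))\<close> falls.
\<close>

definition max_barrier_coeff :: "real \<Rightarrow> real \<Rightarrow> real" where
  "max_barrier_coeff \<beta> h = (h * (1 - \<beta>) / 2) powr (1 / (1 - \<beta>))"

lemma max_barrier_coeff_pos: "\<beta> < 1 \<Longrightarrow> 0 < h \<Longrightarrow> 0 < max_barrier_coeff \<beta> h"
  by (simp add: max_barrier_coeff_def)

lemma barrier_coeff_ineq:
  assumes "0 < \<beta>" "\<beta> < 1" "0 < h" "0 < a" "a \<le> max_barrier_coeff \<beta> h"
  shows "a / (1 - \<beta>) + a \<le> h * a powr \<beta>"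
proof -
  have "a powr (1 - \<beta>) \<le> max_barrier_coeff \<beta> h powr (1 - \<beta>)"
    using assms by (intro powr_mono2) auto
  also have "\<dots> = h * (1 - \<beta>) / 2"
    using assms by (simp add: max_barrier_coeff_def powr_powr)
  finally have "a powr (1 - \<beta>) * a powr \<beta> \<le> h * (1 - \<beta>) / 2 * a powr \<beta>"
    by (rule mult_right_mono) simp
  moreover have "a powr (1 - \<beta>) * a powr \<beta> = a"
    using assms by (simp flip: powr_add)
  ultimately have "2 * a / (1 - \<beta>) \<le> h * a powr \<beta>"
    using assms by (simp add: field_simps)
  moreover have "a \<le> a / (1 - \<beta>)" using assms by (simp add: field_simps)
  ultimately show ?thesis by simp
qed

text \<open>
  With \<open>z r = a * \<bar>r\<bar> powr (1 / (1 - \<beta>))\<close> all three terms of the differential inequality are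
  multiples of the same power of \<^term>\<open>\<bar>r\<bar>\<close>, because the exponent of both \<open>z'\<close> and
  \<open>z powr \<beta>\<close> is \<^term>\<open>\<beta> / (1 - \<beta>)\<close>. What remains is the inequality between coefficients in
  \<open>barrier_coeff_ineq\<close>, in which the summand \<^term>\<open>a\<close> alone accounts for \<^term>\<open>p\<close>.
\<close>

lemma subsolution_le_power_barrier:
  assumes "0 < \<beta>" "\<beta> < 1" "0 < h" and a: "0 < a" "a \<le> max_barrier_coeff \<beta> h"
    and sub: "subsolution \<beta> h p s y0 y"
    and "s \<le> t" "t < 0"
    and p: "\<And>r. r \<le> t \<Longrightarrow> \<bar>p r\<bar> \<le> a * \<bar>r\<bar> powr (\<beta> / (1 - \<beta>))"
    and y0: "y0 \<le> a * \<bar>s\<bar> powr (1 / (1 - \<beta>))"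
  shows "y t \<le> a * \<bar>t\<bar> powr (1 / (1 - \<beta>))"
proof -
  define \<gamma> where "\<gamma> = 1 / (1 - \<beta>)"
  have \<gamma>: "\<beta> / (1 - \<beta>) = \<gamma> - 1" "\<gamma> * \<beta> = \<gamma> - 1"
    using assms by (auto simp: \<gamma>_def field_simps)
  define z z' where "z = (\<lambda>r. a * (- r) powr \<gamma>)" and "z' = (\<lambda>r. - (a * \<gamma> * (- r) powr (\<gamma> - 1)))"
  have "y t \<le> z t"
  proof (rule subsolution_le_barrier[OF sub, where a = s and z' = z'])
    show "continuous_on {s..t} z'" unfolding z'_def
      using \<open>t < 0\<close> by (intro continuous_intros) auto
    show "y s \<le> z s" using sub y0 \<open>s \<le> t\<close> \<open>t < 0\<close> by (simp add: subsolution_def z_def \<gamma>_def)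
  next
    fix r assume r: "r \<in> {s..t}"
    with \<open>t < 0\<close> have "r < 0" by simp
    show "(z has_real_derivative z' r) (at r within {s..t})"
      unfolding z_def z'_def using \<open>r < 0\<close>
      by (auto intro!: derivative_eq_intros simp: algebra_simps)
    show "0 \<le> z r" using a by (simp add: z_def)
    have "z r powr \<beta> = a powr \<beta> * (- r) powr (\<gamma> - 1)"
      using a \<open>r < 0\<close> by (simp add: z_def powr_mult powr_powr \<gamma>)
    moreover have "p r \<le> a * (- r) powr (\<gamma> - 1)"
      using p[of r] r \<open>r < 0\<close> by (simp add: \<gamma>)
    moreover have "(a * \<gamma> + a) * (- r) powr (\<gamma> - 1) \<le> h * a powr \<beta> * (- r) powr (\<gamma> - 1)"
      using barrier_coeff_ineq[OF assms(1-3) a] by (intro mult_right_mono) (auto simp: \<gamma>_def)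
    ultimately show "- h * z r powr \<beta> + p r \<le> z' r"
      by (simp add: z'_def algebra_simps)
  qed (use assms in auto)
  then show ?thesis using \<open>t < 0\<close> by (simp add: z_def \<gamma>_def)
qed

text \<open>
  A crude bound that ignores the damping. It covers the bounded stretch of time on which the
  growth condition on \<^term>\<open>p\<close> gives no information.
\<close>

lemma subsolution_le_linear_barrier:
  assumes "0 \<le> \<beta>" "0 \<le> h" and sub: "subsolution \<beta> h p s y0 y" and "s \<le> a" "a \<le> b"
    and "y a \<le> c" "0 \<le> c" "0 \<le> K" and p: "\<And>r. r \<in> {a..b} \<Longrightarrow> p r \<le> K"
  shows "y b \<le> c + K * (b - a)"
proof (rule subsolution_le_barrier[OF sub, where a = a and z = "\<lambda>r. c + K * (r - a)" and z' = "\<lambda>_. K"])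
  fix r assume r: "r \<in> {a..b}"
  show "- h * (c + K * (r - a)) powr \<beta> + p r \<le> K"
    using p[OF r] mult_nonneg_nonneg[OF \<open>0 \<le> h\<close>, of "(c + K * (r - a)) powr \<beta>"] by simp
  show "((\<lambda>r. c + K * (r - a)) has_real_derivative K) (at r within {a..b})"
    by (auto intro!: derivative_eq_intros)
qed (use assms in auto)

section \<open>A bound uniform in the starting time\<close>

text \<open>
  The coefficient of the power barrier under which subsolutions have to start in order to be
  bounded at time \<^term>\<open>t\<close>. It must tend to 0 as \<open>t \<rightarrow> -\<infinity>\<close> at a rate that does not involve
  the forcing term, since the time before which they start may not depend on it; any such rate
  would do in place of \<open>1 / (1 + \<bar>t\<bar>)\<close>.
\<close>

definition admissible_coeff :: "real \<Rightarrow> real \<Rightarrow> real \<Rightarrow> real" where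
  "admissible_coeff \<beta> h t = min (max_barrier_coeff \<beta> h) (1 / (1 + \<bar>t\<bar>))"

definition entry_time :: "real \<Rightarrow> real \<Rightarrow> (real \<Rightarrow> real) \<Rightarrow> real \<Rightarrow> real" where
  "entry_time \<beta> t sq h = min t (sq (admissible_coeff \<beta> h t))"

text \<open>
  Collecting all subsolutions that start below the admissible barrier makes the supremum of this
  set depend on the forcing term, on \<^term>\<open>h\<close> and on \<^term>\<open>t\<close> only, and not on any particular
  family of subsolutions or initial values.
\<close>

definition subsolution_values ::
    "real \<Rightarrow> real \<Rightarrow> (real \<Rightarrow> real) \<Rightarrow> real \<Rightarrow> real set" where
  "subsolution_values \<beta> h p t =
    {y t | y s y0. subsolution \<beta> h p s y0 y \<and> s \<le> t \<and>
      y0 \<le> admissible_coeff \<beta> h t * \<bar>s\<bar> powr (1 / (1 - \<beta>))}"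

lemma admissible_coeff_pos: "\<beta> < 1 \<Longrightarrow> 0 < h \<Longrightarrow> 0 < admissible_coeff \<beta> h t"
  by (simp add: admissible_coeff_def max_barrier_coeff_pos add_pos_nonneg)

lemma subsolution_values_le_power:
  assumes "0 < \<beta>" "\<beta> < 1" "0 < h"
    and a: "admissible_coeff \<beta> h t \<le> a" "a \<le> max_barrier_coeff \<beta> h" and "t < 0"
    and p: "\<And>r. r \<le> t \<Longrightarrow> \<bar>p r\<bar> \<le> a * \<bar>r\<bar> powr (\<beta> / (1 - \<beta>))"
    and x: "x \<in> subsolution_values \<beta> h p t"
  shows "x \<le> a * \<bar>t\<bar> powr (1 / (1 - \<beta>))"
proof -
  from x obtain y s y0 where y: "x = y t" "subsolution \<beta> h p s y0 y" "s \<le> t"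
    "y0 \<le> admissible_coeff \<beta> h t * \<bar>s\<bar> powr (1 / (1 - \<beta>))"
    by (auto simp: subsolution_values_def)
  have "0 < a" using admissible_coeff_pos[OF assms(2,3), of t] a(1) by linarith
  moreover have "y0 \<le> a * \<bar>s\<bar> powr (1 / (1 - \<beta>))"
    using y(4) mult_right_mono[OF a(1), of "\<bar>s\<bar> powr (1 / (1 - \<beta>))"] by simp
  ultimately show ?thesis
    unfolding y(1) using subsolution_le_power_barrier[OF assms(1-3) _ a(2) y(2,3) \<open>t < 0\<close> p] by blast
qed

text \<open>
  Up to a time \<open>\<tau>\<close> before which \<^term>\<open>p\<close> is small, the power barrier applies; from
  \<open>\<tau>\<close> to \<^term>\<open>t\<close> the linear one does. A subsolution that starts only after \<open>\<tau>\<close> is not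
  larger at its start than the power barrier, which is bounded on the interval from \<open>\<tau>\<close>
  to \<^term>\<open>t\<close>.
\<close>

lemma bdd_above_subsolution_values:
  assumes "0 < \<beta>" "\<beta> < 1" "0 < h" and "cadlag p"
    and p: "\<And>\<epsilon> r. 0 < \<epsilon> \<Longrightarrow> r \<le> sp \<epsilon> \<Longrightarrow> \<bar>p r\<bar> \<le> \<epsilon> * \<bar>r\<bar> powr (\<beta> / (1 - \<beta>))"
  shows "bdd_above (subsolution_values \<beta> h p t)"
proof -
  define a where "a = admissible_coeff \<beta> h t"
  have a: "0 < a" "a \<le> max_barrier_coeff \<beta> h"
    using admissible_coeff_pos[OF assms(2,3)] by (auto simp: a_def admissible_coeff_def)
  \<comment> \<open>negative, because the power barrier is a supersolution only on the negative half-line\<close>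
  define \<tau> where "\<tau> = min t (min (sp a) (- 1))"
  have \<tau>: "\<tau> \<le> t" "\<tau> \<le> sp a" "\<tau> < 0" by (auto simp: \<tau>_def)
  define c where "c = a * (\<bar>\<tau>\<bar> + \<bar>t\<bar>) powr (1 / (1 - \<beta>))"
  obtain K' where K': "\<forall>r\<in>{\<tau>..t}. \<bar>p r\<bar> \<le> K'"
    using cadlag_bounded_on_interval[OF \<open>cadlag p\<close> \<tau>(1)] by blast
  define K where "K = max 0 K'"
  have K: "p r \<le> K" if "r \<in> {\<tau>..t}" for r
    using K' that by (fastforce simp: K_def)
  have "0 \<le> K" by (simp add: K_def)
  have "0 \<le> c" using a by (simp add: c_def)
  show ?thesis
  proof (rule bdd_aboveI)
    fix x assume "x \<in> subsolution_values \<beta> h p t"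
    then obtain y s y0 where y: "x = y t" "subsolution \<beta> h p s y0 y" "s \<le> t"
      and y0: "y0 \<le> a * \<bar>s\<bar> powr (1 / (1 - \<beta>))"
      by (auto simp: subsolution_values_def a_def)
    have le_c: "a * \<bar>r\<bar> powr (1 / (1 - \<beta>)) \<le> c" if "r \<in> {\<tau>..t}" for r
      unfolding c_def using that a \<open>\<beta> < 1\<close> \<tau> by (intro mult_left_mono powr_mono2) auto
    \<comment> \<open>from here on the linear barrier takes over\<close>
    have "y (max s \<tau>) \<le> c"
    proof (cases "s \<le> \<tau>")
      case True
      then have "y \<tau> \<le> a * \<bar>\<tau>\<bar> powr (1 / (1 - \<beta>))"
        using p[OF a(1)] \<tau>(2) order_trans
        by (intro subsolution_le_power_barrier[OF assms(1-3) a y(2) _ \<tau>(3) _ y0]) blast+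
      with le_c[of \<tau>] \<tau> True show ?thesis by (simp add: max_absorb2)
    next
      case False
      have "y s \<le> y0" using y(2) by (simp add: subsolution_def)
      with y0 le_c[of s] False y(3) show ?thesis by (simp add: max_absorb1)
    qed
    then have "y t \<le> c + K * (t - max s \<tau>)"
      using assms(1-3) y(3) \<tau>(1)
      by (intro subsolution_le_linear_barrier[OF _ _ y(2) _ _ _ \<open>0 \<le> c\<close> \<open>0 \<le> K\<close> K]) auto
    also have "\<dots> \<le> c + K * (t - \<tau>)"
      using \<open>0 \<le> K\<close> by (intro add_left_mono mult_left_mono) auto
    finally show "x \<le> c + K * (t - \<tau>)" unfolding y(1) .
  qed
qed

text \<open>
  Inserting 1 makes the set nonempty and the bound positive; for \<open>t \<rightarrow> -\<infinity>\<close> a constant is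
  negligible.
\<close>

definition uniform_bound ::
    "real \<Rightarrow> real \<Rightarrow> (real \<Rightarrow> real) \<Rightarrow> real \<Rightarrow> real" where
  "uniform_bound \<beta> t p h = Sup (insert 1 (subsolution_values \<beta> h p t))"

text \<open>
  Given \<open>a > 0\<close>, the admissible coefficient is at most \<open>a\<close> for all very negative
  \<^term>\<open>t\<close>, and \<^term>\<open>p\<close> is small enough for the barrier with coefficient \<open>a\<close> up to time
  \<^term>\<open>sp a\<close>. So the barrier with coefficient \<open>a\<close> holds up to time \<^term>\<open>t\<close>. How negative
  \<^term>\<open>t\<close> has to be depends on \<^term>\<open>sp\<close>, but the set of subsolutions considered does not.
\<close>

lemma uniform_bound_smallo:
  assumes "0 < \<beta>" "\<beta> < 1" "0 < h" and "cadlag p"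
    and p: "\<And>\<epsilon> r. 0 < \<epsilon> \<Longrightarrow> r \<le> sp \<epsilon> \<Longrightarrow> \<bar>p r\<bar> \<le> \<epsilon> * \<bar>r\<bar> powr (\<beta> / (1 - \<beta>))"
  shows "(\<lambda>t. uniform_bound \<beta> t p h) \<in> o[at_bot](\<lambda>t. \<bar>t\<bar> powr (1 / (1 - \<beta>)))"
proof (rule landau_o.smallI)
  fix c :: real assume "0 < c"
  define a where "a = min c (max_barrier_coeff \<beta> h)"
  have a: "0 < a" "a \<le> c" "a \<le> max_barrier_coeff \<beta> h"
    using \<open>0 < c\<close> max_barrier_coeff_pos[OF assms(2,3)] by (auto simp: a_def)
  have "\<forall>\<^sub>F t in at_bot. t \<le> min (- 1) (min (sp a) (- (1 / a)))"
    by (rule eventually_le_at_bot)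
  moreover have "filterlim (\<lambda>t. \<bar>t\<bar> powr (1 / (1 - \<beta>))) at_top at_bot"
    using \<open>\<beta> < 1\<close> by real_asymp
  then have "\<forall>\<^sub>F t in at_bot. 1 / c \<le> \<bar>t\<bar> powr (1 / (1 - \<beta>))"
    by (simp add: filterlim_at_top)
  ultimately show "\<forall>\<^sub>F t in at_bot. norm (uniform_bound \<beta> t p h) \<le> c * norm (\<bar>t\<bar> powr (1 / (1 - \<beta>)))"
  proof eventually_elim
    case (elim t)
    let ?S = "subsolution_values \<beta> h p t"
    have t: "t < 0" "t \<le> sp a" "1 / a \<le> \<bar>t\<bar>" using elim(1) by auto
    have "1 / (1 + \<bar>t\<bar>) \<le> a"
      using t a(1) by (simp add: field_simps)
    then have coeff: "admissible_coeff \<beta> h t \<le> a" by (simp add: admissible_coeff_def min.coboundedI2)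
    have "x \<le> c * \<bar>t\<bar> powr (1 / (1 - \<beta>))" if "x \<in> insert 1 ?S" for x
    proof (cases "x = 1")
      case True
      then show ?thesis using elim(2) \<open>0 < c\<close> by (simp add: field_simps)
    next
      case False
      then have "x \<le> a * \<bar>t\<bar> powr (1 / (1 - \<beta>))"
        using that p[OF a(1)] t(2) order_trans
        by (intro subsolution_values_le_power[OF assms(1-3) coeff a(3) t(1), of p]) blast+
      also have "\<dots> \<le> c * \<bar>t\<bar> powr (1 / (1 - \<beta>))" using a(2) by (intro mult_right_mono) auto
      finally show ?thesis .
    qed
    then have "uniform_bound \<beta> t p h \<le> c * \<bar>t\<bar> powr (1 / (1 - \<beta>))"
      unfolding uniform_bound_def by (intro cSup_least) auto
    moreover have "1 \<le> uniform_bound \<beta> t p h"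
      using bdd_above_subsolution_values[OF assms(1-4) p, where t = t and sp = sp]
      unfolding uniform_bound_def by (intro cSup_upper) auto
    ultimately show ?case by simp
  qed
qed

theorem lemma5p3:
  fixes \<beta> :: real
  assumes "0 < \<beta>" and "\<beta> < 1"
  shows "\<exists>(s0 :: real \<Rightarrow> (real \<Rightarrow> real) \<Rightarrow> real \<Rightarrow> real)
          (R :: real \<Rightarrow> (real \<Rightarrow> real) \<Rightarrow> (real \<Rightarrow> real) \<Rightarrow> real \<Rightarrow> real).
    \<forall>(h :: real) (p :: real \<Rightarrow> real) (q :: real \<Rightarrow> real) (v :: real \<Rightarrow> real \<Rightarrow> real)
     (sp :: real \<Rightarrow> real) (sq :: real \<Rightarrow> real).
      0 < h \<longrightarrow>
      cadlag p \<longrightarrow>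
      (\<forall>s. 0 \<le> q s) \<longrightarrow>
      (\<forall>s r. s \<le> r \<longrightarrow> 0 \<le> v r s) \<longrightarrow>
      (\<forall>s. subsolution \<beta> h p s (q s) (\<lambda>r. v r s)) \<longrightarrow>
      (\<forall>\<epsilon>>0. \<forall>s\<le>sp \<epsilon>. \<bar>p s\<bar> \<le> \<epsilon> * \<bar>s\<bar> powr (\<beta> / (1 - \<beta>))) \<longrightarrow>
      (\<forall>\<epsilon>>0. \<forall>s\<le>sq \<epsilon>. q s \<le> \<epsilon> * \<bar>s\<bar> powr (1 / (1 - \<beta>))) \<longrightarrow>
      (\<forall>t. s0 t sq h \<le> t \<and> 0 < R t p sp h \<and>
        (\<forall>s\<le>s0 t sq h. v t s \<le> R t p sp h)) \<and>
      (\<lambda>t. R t p sp h) \<in> o[at_bot](\<lambda>t. \<bar>t\<bar> powr (1 / (1 - \<beta>)))"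
proof (intro exI[of _ "entry_time \<beta>"] exI[of _ "\<lambda>t p _. uniform_bound \<beta> t p"] allI impI)
  fix h :: real and p q :: "real \<Rightarrow> real" and v :: "real \<Rightarrow> real \<Rightarrow> real" and sp sq :: "real \<Rightarrow> real"
  assume "0 < h" "cadlag p"
    and sub: "\<forall>s. subsolution \<beta> h p s (q s) (\<lambda>r. v r s)"
    and p: "\<forall>\<epsilon>>0. \<forall>s\<le>sp \<epsilon>. \<bar>p s\<bar> \<le> \<epsilon> * \<bar>s\<bar> powr (\<beta> / (1 - \<beta>))"
    and q: "\<forall>\<epsilon>>0. \<forall>s\<le>sq \<epsilon>. q s \<le> \<epsilon> * \<bar>s\<bar> powr (1 / (1 - \<beta>))"
  have upper: "x \<le> uniform_bound \<beta> t p h" if "x \<in> insert 1 (subsolution_values \<beta> h p t)" for x t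
    unfolding uniform_bound_def
    using bdd_above_subsolution_values[OF assms \<open>0 < h\<close> \<open>cadlag p\<close>, of sp t] p that
    by (intro cSup_upper) auto
  have "entry_time \<beta> t sq h \<le> t \<and> 0 < uniform_bound \<beta> t p h \<and>
    (\<forall>s\<le>entry_time \<beta> t sq h. v t s \<le> uniform_bound \<beta> t p h)" for t
  proof (intro conjI allI impI)
    show "entry_time \<beta> t sq h \<le> t" by (simp add: entry_time_def)
    show "0 < uniform_bound \<beta> t p h" using upper[of 1 t] by simp
    fix s assume s: "s \<le> entry_time \<beta> t sq h"
    then have "s \<le> t" "s \<le> sq (admissible_coeff \<beta> h t)" by (auto simp: entry_time_def)
    then have "q s \<le> admissible_coeff \<beta> h t * \<bar>s\<bar> powr (1 / (1 - \<beta>))"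
      using q admissible_coeff_pos[OF assms(2) \<open>0 < h\<close>] by blast
    with sub \<open>s \<le> t\<close> have "v t s \<in> subsolution_values \<beta> h p t"
      unfolding subsolution_values_def
      by (intro CollectI exI[of _ "\<lambda>r. v r s"] exI[of _ s] exI[of _ "q s"]) simp
    then show "v t s \<le> uniform_bound \<beta> t p h" by (intro upper) simp
  qed
  moreover have "(\<lambda>t. uniform_bound \<beta> t p h) \<in> o[at_bot](\<lambda>t. \<bar>t\<bar> powr (1 / (1 - \<beta>)))"
    using p by (intro uniform_bound_smallo[OF assms \<open>0 < h\<close> \<open>cadlag p\<close>, of sp]) auto
  ultimately show "(\<forall>t. entry_time \<beta> t sq h \<le> t \<and> 0 < uniform_bound \<beta> t p h \<and>
        (\<forall>s\<le>entry_time \<beta> t sq h. v t s \<le> uniform_bound \<beta> t p h)) \<and>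
      (\<lambda>t. uniform_bound \<beta> t p h) \<in> o[at_bot](\<lambda>t. \<bar>t\<bar> powr (1 / (1 - \<beta>)))"
    by blast
qed

end
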